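(* Let $S$ be a semiring, let $M$ be a nonzero $S$-semimodule that is an Auslander $S$-semimodule and has Property (A), and let $G$ be a cancellative torsion-free commutative monoid. Then $M[G]$ is an Auslander $S[G]$-semimodule.
   Context: A semiring is a set $S$ with operations $+,\cdot$ such that $(S,+)$ is a commutative monoid with identity $0$, $(S,\cdot)$ is a commutative monoid with identity $1\neq 0$, multiplication distributes over addition, and $s\cdot 0=0$ for all $s\in S$. An $S$-semimodule is a commutative monoid $(M,+,0)$ with a scalar multiplication $S\times M\to M$ satisfying the usual module axioms together with $0_S\cdot m=0_M=s\cdot 0_M$ and $1\cdot m=m$. A commutative monoid $G$ (written additively) is cancellative if $a+b=a+c$ implies $b=c$, and torsion-free if $na=nb$ with $n\geq 1$ implies $a=b$. $S[G]$ is the monoid semiring (finite formal sums $\sum s_iX^{g_i}$ with $X^gX^h=X^{g+h}$), and $M[G]$ is the set of finite formal sums $\sum m_iX^{g_i}$, $m_i\in M$, an $S[G]$-semimodule via $(sX^g)(mX^h)=(sm)X^{g+h}$. An ideal of $S$ is a nonempty subset closed under addition and under multiplication by elements of $S$. For a nonzero $S$-semimodule $M$, $Z_S(M)$ is the set of $s\in S$ such that $sm=0$ for some nonzero $m\in M$; $Z(S)=Z_S(S)$. $M$ is an Auslander $S$-semimodule if $Z(S)\subseteq Z_S(M)$. $M$ has Property (A) if every finitely generated ideal $I\subseteq Z_S(M)$ has a nonzero annihilator in $M$, i.e. $I\cdot m=0$ for some nonzero $m\in M$. *)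

theory Defs
  imports "HOL.Hull" "HOL-Library.Poly_Mapping"
begin

text \<open>
  Semirings are types of class \<open>comm_semiring_1\<close>, whose axioms are exactly those of a commutative
  semiring with \<open>0 \<noteq> 1\<close> and absorbing zero.  The library's \<open>module\<close> locale requires rings and
  additive inverses, hence the following semiring version.
\<close>

locale semimodule =
  fixes scale :: "'s::comm_semiring_1 \<Rightarrow> 'm::comm_monoid_add \<Rightarrow> 'm"
  assumes scale_right_distrib: "scale s (m + n) = scale s m + scale s n"
    and scale_left_distrib: "scale (s + t) m = scale s m + scale t m"
    and scale_scale: "scale s (scale t m) = scale (s * t) m"
    and scale_one: "scale 1 m = m"
    and scale_zero_left: "scale 0 m = 0"
    and scale_zero_right: "scale s 0 = 0"

definition zero_divisors :: "('s::comm_semiring_1 \<Rightarrow> 'm::comm_monoid_add \<Rightarrow> 'm) \<Rightarrow> 's set" where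
  "zero_divisors scale = {s. \<exists>m. m \<noteq> 0 \<and> scale s m = 0}"

text \<open>\<open>Z(S)\<close> is \<open>zero_divisors\<close> of the multiplication of \<open>S\<close>, i.e. of \<open>S\<close> as a semimodule over itself.\<close>

definition auslander_semimodule :: "('s::comm_semiring_1 \<Rightarrow> 'm::comm_monoid_add \<Rightarrow> 'm) \<Rightarrow> bool" where
  "auslander_semimodule scale \<longleftrightarrow>
     semimodule scale \<and> (\<exists>m::'m. m \<noteq> 0) \<and>
     zero_divisors ((*) :: 's \<Rightarrow> 's \<Rightarrow> 's) \<subseteq> zero_divisors scale"

definition semiring_ideal :: "'s::comm_semiring_1 set \<Rightarrow> bool" where
  "semiring_ideal I \<longleftrightarrow>
     I \<noteq> {} \<and> (\<forall>a\<in>I. \<forall>b\<in>I. a + b \<in> I) \<and> (\<forall>s. \<forall>a\<in>I. s * a \<in> I)"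

definition fin_gen_ideal :: "'s::comm_semiring_1 set \<Rightarrow> bool" where
  "fin_gen_ideal I \<longleftrightarrow> (\<exists>F. finite F \<and> I = semiring_ideal hull F)"

definition property_A :: "('s::comm_semiring_1 \<Rightarrow> 'm::comm_monoid_add \<Rightarrow> 'm) \<Rightarrow> bool" where
  "property_A scale \<longleftrightarrow>
     (\<forall>I. fin_gen_ideal I \<and> I \<subseteq> zero_divisors scale \<longrightarrow>
        (\<exists>m. m \<noteq> 0 \<and> (\<forall>s\<in>I. scale s m = 0)))"

text \<open>
  The class \<open>cancel_comm_monoid_add\<close> also carries a subtraction satisfying
  \<open>a - b - c = a - (b + c)\<close> for all elements, so cancellativity is stated as a predicate on
  plain commutative monoids instead.
\<close>

definition cancellative :: "'g::comm_monoid_add itself \<Rightarrow> bool" where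
  "cancellative _ \<longleftrightarrow> (\<forall>a b c :: 'g. a + b = a + c \<longrightarrow> b = c)"

text \<open>The \<open>n\<close>-fold multiple \<open>n a\<close> is written as the sum of \<open>n\<close> copies of \<open>a\<close>.\<close>

definition torsion_free :: "'g::comm_monoid_add itself \<Rightarrow> bool" where
  "torsion_free _ \<longleftrightarrow>
     (\<forall>(n::nat) (a::'g) b. n \<ge> 1 \<longrightarrow> (\<Sum>i<n. a) = (\<Sum>i<n. b) \<longrightarrow> a = b)"

text \<open>
  The monoid semiring \<open>S[G]\<close> is \<open>'g \<Rightarrow>\<^sub>0 's\<close> with the library's convolution product, and \<open>M[G]\<close> is
  \<open>'g \<Rightarrow>\<^sub>0 'm\<close>; the monomial \<open>m X\<^sup>g\<close> is \<open>Poly_Mapping.single g m\<close>.  The action is the biadditive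
  extension of \<open>(s X\<^sup>g) (m X\<^sup>h) = (s m) X\<^sup>g\<^sup>+\<^sup>h\<close>.
\<close>

definition monoid_scale ::
    "('s::comm_semiring_1 \<Rightarrow> 'm::comm_monoid_add \<Rightarrow> 'm) \<Rightarrow>
     ('g::comm_monoid_add \<Rightarrow>\<^sub>0 's) \<Rightarrow> ('g \<Rightarrow>\<^sub>0 'm) \<Rightarrow> ('g \<Rightarrow>\<^sub>0 'm)" where
  "monoid_scale scale f u =
     (\<Sum>g\<in>Poly_Mapping.keys f. \<Sum>h\<in>Poly_Mapping.keys u.
        Poly_Mapping.single (g + h) (scale (Poly_Mapping.lookup f g) (Poly_Mapping.lookup u h)))"

lemma (in semimodule) monoid_scale_single:
  "monoid_scale scale (Poly_Mapping.single g s) (Poly_Mapping.single h m) =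
     Poly_Mapping.single (g + h) (scale s m)"
  by (simp add: monoid_scale_def scale_zero_left scale_zero_right)

end

theory Submission
  imports Defs
begin

text \<open>
  Suppose \<open>f u = 0\<close> with \<open>u \<noteq> 0\<close> in \<open>M[G]\<close> and the support of \<open>u\<close> as small as possible.  The supports
  of \<open>f\<close> and \<open>u\<close> have a unique sum \<open>a + b\<close>, so the coefficient \<open>f\<^sub>a\<close> kills \<open>u\<^sub>b\<close>; then \<open>f\<^sub>a u\<close> has smaller
  support and is still annihilated by \<open>f\<close>, hence \<open>f\<^sub>a u = 0\<close>.  So the term at \<open>a\<close> may be dropped from
  \<open>f\<close> without leaving the equation \<open>f u = 0\<close> (no subtraction is needed), and by iteration all
  coefficients of \<open>f\<close> kill \<open>u\<close>.  Applied to \<open>M = S\<close>, this McCoy theorem places the content ideal of a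
  zero-divisor \<open>f\<close> inside \<open>Z(S) \<subseteq> Z\<^sub>S(M)\<close>, and Property (A) provides \<open>m \<noteq> 0\<close> killed by all coefficients
  of \<open>f\<close>.
  Unique sums exist because the equality of \<open>G\<close> extends to a compatible order that is total on any
  given finite set.
\<close>

section \<open>Orders on torsion-free cancellative monoids\<close>

definition nmul :: "nat \<Rightarrow> 'g::comm_monoid_add \<Rightarrow> 'g" where
  "nmul n a = (\<Sum>i<n. a)"

lemma nmul_0 [simp]: "nmul 0 a = 0"
  by (simp add: nmul_def)

lemma nmul_Suc [simp]: "nmul (Suc n) a = a + nmul n a"
  by (simp add: nmul_def add.commute)

lemma nmul_add_left: "nmul (m + n) a = nmul m a + nmul n a"
  by (induction m) (simp_all add: ac_simps)

lemma nmul_add_right: "nmul n (a + b) = nmul n a + nmul n b"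
  by (induction n) (simp_all add: ac_simps)

lemma nmul_nmul: "nmul m (nmul n a) = nmul (m * n) a"
  by (induction m) (simp_all add: nmul_add_left)

text \<open>Orders that can be cancelled and divided: \<open>add_iff\<close> reflects comparisons
  along translations, \<open>isolated\<close> along positive multiples. Both survive adjoining a new
  comparison.\<close>

locale isolated_order =
  fixes le :: "'g::comm_monoid_add \<Rightarrow> 'g \<Rightarrow> bool"
  assumes refl: "le a a"
    and antisym: "le a b \<Longrightarrow> le b a \<Longrightarrow> a = b"
    and trans: "le a b \<Longrightarrow> le b c \<Longrightarrow> le a c"
    and add_iff: "le (a + c) (b + c) \<longleftrightarrow> le a b"
    and isolated: "n \<ge> 1 \<Longrightarrow> le (nmul n a) (nmul n b) \<Longrightarrow> le a b"
begin

lemma add_mono: "le a b \<Longrightarrow> le c d \<Longrightarrow> le (a + c) (b + d)"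
  by (metis add.commute add_iff trans)

lemma nmul_mono: "le a b \<Longrightarrow> le (nmul n a) (nmul n b)"
  by (induction n) (auto intro: add_mono refl)

text \<open>The smallest isolated extension of \<open>le\<close> in which \<open>x\<close> lies below \<open>y\<close>.\<close>

definition adjoin :: "'g \<Rightarrow> 'g \<Rightarrow> 'g \<Rightarrow> 'g \<Rightarrow> bool" where
  "adjoin x y a b \<longleftrightarrow>
     (\<exists>k\<ge>1. \<exists>n. le (nmul k a + nmul n y) (nmul k b + nmul n x))"

lemma adjoin_extends: "le a b \<Longrightarrow> adjoin x y a b"
  unfolding adjoin_def by (intro exI[of _ 1] conjI exI[of _ 0]) auto

lemma adjoin_new: "adjoin x y x y"
  unfolding adjoin_def
  by (intro exI[of _ 1] conjI exI[of _ 1]) (auto simp: add.commute refl)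

text \<open>Multiplying the hypotheses by \<open>l\<close> and \<open>k\<close> turns both middle
  terms into \<open>nmul (k * l) b\<close>, which \<open>add_iff\<close> cancels. The resulting
  multiplier of \<open>x\<close> and \<open>y\<close> is explicit because antisymmetry inspects
  it.\<close>

lemma adjoin_compose:
  assumes "le (nmul k a + nmul n y) (nmul k b + nmul n x)"
    and "le (nmul l b + nmul m y) (nmul l c + nmul m x)"
  shows "le (nmul (k * l) a + nmul (l * n + k * m) y) (nmul (k * l) c + nmul (l * n + k * m) x)"
proof -
  have "le (nmul l (nmul k a + nmul n y) + nmul k (nmul l b + nmul m y))
           (nmul l (nmul k b + nmul n x) + nmul k (nmul l c + nmul m x))"
    by (rule add_mono[OF nmul_mono[OF assms(1)] nmul_mono[OF assms(2)]])
  hence "le ((nmul (k * l) a + nmul (l * n + k * m) y) + nmul (k * l) b)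
            ((nmul (k * l) c + nmul (l * n + k * m) x) + nmul (k * l) b)"
    by (simp add: nmul_add_right nmul_add_left nmul_nmul ac_simps)
  thus ?thesis by (simp only: add_iff)
qed

text \<open>Antisymmetry rests on the hypothesis: going from \<open>a\<close> to \<open>b\<close>
  and back gives \<open>le (nmul N y) (nmul N x)\<close> with \<open>N = l * n + k * m\<close>.
  Isolation would yield \<open>le y x\<close> unless \<open>N = 0\<close>, and then both comparisons
  already come from \<open>le\<close>.\<close>

lemma isolated_order_adjoin:
  assumes "\<not> le y x"
  shows "isolated_order (adjoin x y)"
proof
  show "adjoin x y a a" for a
    by (simp add: adjoin_extends refl)
next
  fix a b assume "adjoin x y a b" "adjoin x y b a"
  then obtain k n l m where k: "k \<ge> 1" "le (nmul k a + nmul n y) (nmul k b + nmul n x)"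
    and l: "l \<ge> 1" "le (nmul l b + nmul m y) (nmul l a + nmul m x)"
    unfolding adjoin_def by blast
  have "le (nmul (l * n + k * m) y) (nmul (l * n + k * m) x)"
    using adjoin_compose[OF k(2) l(2)] by (metis add.commute add_iff)
  hence "l * n + k * m = 0"
    using assms isolated[of "l * n + k * m" y x] by linarith
  hence "n = 0" "m = 0" using k(1) l(1) by auto
  thus "a = b" using k l antisym isolated[of k a b] isolated[of l b a] by simp
next
  fix a b c assume "adjoin x y a b" "adjoin x y b c"
  then obtain k n l m where k: "k \<ge> 1" "le (nmul k a + nmul n y) (nmul k b + nmul n x)"
    and l: "l \<ge> 1" "le (nmul l b + nmul m y) (nmul l c + nmul m x)"
    unfolding adjoin_def by blast
  have "k * l \<ge> 1" using k(1) l(1) by simp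
  thus "adjoin x y a c"
    unfolding adjoin_def using adjoin_compose[OF k(2) l(2)] by blast
next
  fix a b c :: 'g
  have "nmul k (d + c) + e = (nmul k d + e) + nmul k c" for k and d e :: 'g
    by (simp add: nmul_add_right ac_simps)
  thus "adjoin x y (a + c) (b + c) \<longleftrightarrow> adjoin x y a b"
    unfolding adjoin_def by (simp only: add_iff)
next
  fix j a b assume j: "(j::nat) \<ge> 1" and "adjoin x y (nmul j a) (nmul j b)"
  then obtain k n where k: "k \<ge> 1"
      "le (nmul (k * j) a + nmul n y) (nmul (k * j) b + nmul n x)"
    unfolding adjoin_def nmul_nmul by blast
  have "k * j \<ge> 1" using k(1) j by simp
  thus "adjoin x y a b"
    unfolding adjoin_def using k(2) by blast
qed

end

text \<open>For equality, \<open>add_iff\<close> is cancellativity and \<open>isolated\<close> is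
  torsion-freeness; the hypotheses on \<open>G\<close> enter the argument only through this starting
  point.\<close>

lemma isolated_order_eq:
  assumes "cancellative TYPE('g::comm_monoid_add)" and "torsion_free TYPE('g)"
  shows "isolated_order ((=) :: 'g \<Rightarrow> 'g \<Rightarrow> bool)"
  using assms unfolding cancellative_def torsion_free_def nmul_def[symmetric]
  by unfold_locales (metis add.commute)+

text \<open>Pairs are made comparable one at a time, and each extension keeps the earlier
  comparisons; finiteness of \<open>P\<close> replaces Zorn's lemma.\<close>

lemma exists_isolated_order_comparing:
  assumes "cancellative TYPE('g::comm_monoid_add)" and "torsion_free TYPE('g)"
    and "finite (P :: ('g \<times> 'g) set)"
  shows "\<exists>le. isolated_order le \<and> (\<forall>(x, y)\<in>P. le x y \<or> le y x)"
  using assms(3)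
proof (induction P)
  case empty
  show ?case using isolated_order_eq[OF assms(1,2)] by auto
next
  case (insert p P)
  then obtain le where le: "isolated_order le" "\<forall>(x, y)\<in>P. le x y \<or> le y x" by blast
  interpret isolated_order le by (fact le(1))
  obtain x y where p: "p = (x, y)" by fastforce
  show ?case
  proof (cases "le y x")
    case True
    thus ?thesis using le p by auto
  next
    case False
    have "\<forall>(u, v)\<in>insert p P. adjoin x y u v \<or> adjoin x y v u"
      using le(2) p by (auto intro: adjoin_new adjoin_extends)
    thus ?thesis using isolated_order_adjoin[OF False] by blast
  qed
qed

lemma (in isolated_order) exists_greatest:
  assumes "finite A" and "A \<noteq> {}" and "\<And>x y. x \<in> A \<Longrightarrow> y \<in> A \<Longrightarrow> le x y \<or> le y x"
  shows "\<exists>m\<in>A. \<forall>x\<in>A. le x m"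
  using assms
proof (induction A rule: finite_ne_induct)
  case (singleton x)
  thus ?case by (simp add: refl)
next
  case (insert a A)
  then obtain m where "m \<in> A" "\<forall>x\<in>A. le x m" by auto
  moreover have "le a m \<or> le m a" using insert.prems \<open>m \<in> A\<close> by auto
  ultimately show ?case using trans refl by (metis insert_iff)
qed

text \<open>Greatest elements \<open>a\<close> and \<open>b\<close> work: if
  \<open>x + y = a + b\<close>, then \<open>a + b\<close> is at most \<open>a + y\<close> and
  \<open>x + b\<close>, and cancelling gives \<open>le b y\<close> and
  \<open>le a x\<close>.\<close>

lemma unique_sum:
  fixes A B :: "'g::comm_monoid_add set"
  assumes "cancellative TYPE('g)" and "torsion_free TYPE('g)"
    and "finite A" "A \<noteq> {}" "finite B" "B \<noteq> {}"
  obtains a b where "a \<in> A" "b \<in> B"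
    "\<And>x y. x \<in> A \<Longrightarrow> y \<in> B \<Longrightarrow> x + y = a + b \<longleftrightarrow> x = a \<and> y = b"
proof -
  obtain le where "isolated_order le" and tot: "\<forall>(x, y)\<in>A \<times> A \<union> B \<times> B. le x y \<or> le y x"
    using exists_isolated_order_comparing[OF assms(1,2)] assms(3,5)
    by (metis finite_SigmaI finite_UnI)
  interpret isolated_order le by fact
  obtain a where a: "a \<in> A" "\<forall>x\<in>A. le x a"
    using exists_greatest[of A] assms tot by blast
  obtain b where b: "b \<in> B" "\<forall>x\<in>B. le x b"
    using exists_greatest[of B] assms tot by blast
  have "x = a \<and> y = b" if "x \<in> A" "y \<in> B" "x + y = a + b" for x y
  proof -
    have "le (a + b) (a + y)" "le (a + b) (x + b)"
      using that a b by (metis add_mono refl)+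
    hence "le a x" "le b y" by (metis add.commute add_iff)+
    thus ?thesis using that a b antisym by blast
  qed
  thus ?thesis using that a(1) b(1) by blast
qed

section \<open>The action of \<open>S[G]\<close> on \<open>M[G]\<close>\<close>

text \<open>Reduces identities that are additive in an argument to the case of monomials.\<close>

lemma poly_mapping_monomial_induct:
  fixes f :: "'a \<Rightarrow>\<^sub>0 'b::comm_monoid_add"
  assumes "P 0" and "\<And>f g. P f \<Longrightarrow> P g \<Longrightarrow> P (f + g)" and "\<And>k c. P (Poly_Mapping.single k c)"
  shows "P f"
proof -
  have "P (\<Sum>k\<in>A. Poly_Mapping.single k (Poly_Mapping.lookup f k))" for A
    by (induction A rule: infinite_finite_induct) (simp_all add: assms)
  moreover have "(\<Sum>k\<in>Poly_Mapping.keys f. Poly_Mapping.single k (Poly_Mapping.lookup f k)) = f"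
    by (intro poly_mapping_eqI) (simp add: lookup_sum lookup_single when_def in_keys_iff)
  ultimately show ?thesis by metis
qed

context semimodule
begin

text \<open>Additivity needs one index set for several supports, as the support of a sum can be
  smaller than the union; the extra terms vanish.\<close>

lemma monoid_scale_superset:
  assumes "finite A" "Poly_Mapping.keys f \<subseteq> A" "finite B" "Poly_Mapping.keys u \<subseteq> B"
  shows "monoid_scale scale f u =
    (\<Sum>g\<in>A. \<Sum>h\<in>B.
      Poly_Mapping.single (g + h) (scale (Poly_Mapping.lookup f g) (Poly_Mapping.lookup u h)))"
proof -
  have "(\<Sum>h\<in>Poly_Mapping.keys u. Poly_Mapping.single (g + h) (scale s (Poly_Mapping.lookup u h)))
    = (\<Sum>h\<in>B. Poly_Mapping.single (g + h) (scale s (Poly_Mapping.lookup u h)))" for g s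
    using assms by (intro sum.mono_neutral_left) (auto simp: in_keys_iff scale_zero_right)
  thus ?thesis
    unfolding monoid_scale_def using assms
    by (simp only:) (intro sum.mono_neutral_left, auto simp: in_keys_iff scale_zero_left)
qed

lemma monoid_scale_add_left:
  "monoid_scale scale (f + f') u = monoid_scale scale f u + monoid_scale scale f' u"
proof -
  let ?A = "Poly_Mapping.keys f \<union> Poly_Mapping.keys f'"
  have "Poly_Mapping.keys (f + f') \<subseteq> ?A" by (rule Poly_Mapping.keys_add)
  thus ?thesis
    by (simp add: monoid_scale_superset[where A = ?A and B = "Poly_Mapping.keys u"]
        lookup_add scale_left_distrib single_add sum.distrib)
qed

lemma monoid_scale_add_right:
  "monoid_scale scale f (u + v) = monoid_scale scale f u + monoid_scale scale f v"
proof -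
  let ?B = "Poly_Mapping.keys u \<union> Poly_Mapping.keys v"
  have "Poly_Mapping.keys (u + v) \<subseteq> ?B" by (rule Poly_Mapping.keys_add)
  thus ?thesis
    by (simp add: monoid_scale_superset[where B = ?B and A = "Poly_Mapping.keys f"]
        lookup_add scale_right_distrib single_add sum.distrib)
qed

lemma monoid_scale_zero_left: "monoid_scale scale 0 u = 0"
  by (simp add: monoid_scale_def)

lemma monoid_scale_zero_right: "monoid_scale scale f 0 = 0"
  by (simp add: monoid_scale_def)

lemma monoid_scale_monoid_scale:
  fixes f g :: "'g::comm_monoid_add \<Rightarrow>\<^sub>0 's"
  shows "monoid_scale scale f (monoid_scale scale g u) = monoid_scale scale (f * g) u"
proof (induction f rule: poly_mapping_monomial_induct)
  case (3 a s)
  show ?case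
  proof (induction g rule: poly_mapping_monomial_induct)
    case (3 b t)
    show ?case
    proof (induction u rule: poly_mapping_monomial_induct)
      case (3 c m)
      show ?case
        by (simp add: monoid_scale_single mult_single scale_scale add.assoc)
    qed (simp_all add: monoid_scale_add_right monoid_scale_zero_right)
  qed (simp_all add: monoid_scale_add_left monoid_scale_add_right monoid_scale_zero_left
      monoid_scale_zero_right distrib_left)
qed (simp_all add: monoid_scale_add_left monoid_scale_zero_left distrib_right)

lemma monoid_scale_one: "monoid_scale scale 1 u = u"
  by (induction u rule: poly_mapping_monomial_induct)
     (simp_all add: monoid_scale_add_right monoid_scale_zero_right monoid_scale_single scale_one
       del: single_one flip: single_one)

lemma semimodule_monoid_scale: "semimodule (monoid_scale scale)"
  by unfold_locales
     (simp_all add: monoid_scale_add_left monoid_scale_add_right monoid_scale_zero_left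
       monoid_scale_zero_right monoid_scale_one monoid_scale_monoid_scale)

lemma lookup_monoid_scale_const:
  "Poly_Mapping.lookup (monoid_scale scale (Poly_Mapping.single 0 s) u) k =
     scale s (Poly_Mapping.lookup u k)"
  by (induction u rule: poly_mapping_monomial_induct)
     (simp_all add: monoid_scale_zero_right monoid_scale_add_right monoid_scale_single lookup_add
       scale_right_distrib scale_zero_right lookup_single when_def)

lemma lookup_monoid_scale_unique:
  assumes "a \<in> Poly_Mapping.keys f" and "b \<in> Poly_Mapping.keys u"
    and "\<And>x y. x \<in> Poly_Mapping.keys f \<Longrightarrow> y \<in> Poly_Mapping.keys u \<Longrightarrow>
           x + y = a + b \<longleftrightarrow> x = a \<and> y = b"
  shows "Poly_Mapping.lookup (monoid_scale scale f u) (a + b) =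
     scale (Poly_Mapping.lookup f a) (Poly_Mapping.lookup u b)"
proof -
  let ?c = "\<lambda>x y. scale (Poly_Mapping.lookup f x) (Poly_Mapping.lookup u y)"
  have "Poly_Mapping.lookup (monoid_scale scale f u) (a + b) =
      (\<Sum>x\<in>Poly_Mapping.keys f. \<Sum>y\<in>Poly_Mapping.keys u. ?c x y when x + y = a + b)"
    by (simp add: monoid_scale_def lookup_sum lookup_single)
  also have "\<dots> = (\<Sum>x\<in>Poly_Mapping.keys f. \<Sum>y\<in>Poly_Mapping.keys u.
      if y = b then if x = a then ?c x y else 0 else 0)"
    using assms(3) by (intro sum.cong HOL.refl) (auto simp: when_def)
  also have "\<dots> = ?c a b"
    using assms(1,2) by simp
  finally show ?thesis .
qed

section \<open>McCoy's theorem\<close>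

theorem McCoy:
  fixes f :: "'g::comm_monoid_add \<Rightarrow>\<^sub>0 's"
  assumes G: "cancellative TYPE('g)" "torsion_free TYPE('g)"
    and "monoid_scale scale f u = 0" and "u \<noteq> 0"
  shows "\<exists>m. m \<noteq> 0 \<and> (\<forall>g. scale (Poly_Mapping.lookup f g) m = 0)"
proof -
  define ann where "ann v \<longleftrightarrow> v \<noteq> 0 \<and> monoid_scale scale f v = 0" for v
  have "ann u" using assms by (simp add: ann_def)
  then obtain v where v: "ann v"
    and min: "\<And>w. ann w \<Longrightarrow> card (Poly_Mapping.keys v) \<le> card (Poly_Mapping.keys w)"
    using exists_least_iff[of "\<lambda>n. \<exists>v. ann v \<and> card (Poly_Mapping.keys v) = n"]
    by (metis linorder_not_less)
  have kill: "monoid_scale scale (Poly_Mapping.single 0 (Poly_Mapping.lookup f a)) v = 0"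
    if "a \<in> Poly_Mapping.keys f'" "monoid_scale scale f' v = 0"
      "\<And>k. k \<in> Poly_Mapping.keys f' \<Longrightarrow> Poly_Mapping.lookup f' k = Poly_Mapping.lookup f k"
    for f' a
    using that
  proof (induction "card (Poly_Mapping.keys f')" arbitrary: f' rule: less_induct)
    case less
    have "Poly_Mapping.keys f' \<noteq> {}" "Poly_Mapping.keys v \<noteq> {}"
      using less.prems(1) v by (auto simp: ann_def)
    then obtain c d where c: "c \<in> Poly_Mapping.keys f'" and d: "d \<in> Poly_Mapping.keys v"
      and uniq: "\<And>x y. x \<in> Poly_Mapping.keys f' \<Longrightarrow> y \<in> Poly_Mapping.keys v \<Longrightarrow>
        x + y = c + d \<longleftrightarrow> x = c \<and> y = d"
      using unique_sum[OF G] finite_keys by metis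
    let ?s = "Poly_Mapping.lookup f c"
    let ?w = "monoid_scale scale (Poly_Mapping.single 0 ?s) v"
    \<comment> \<open>This is the coefficient of \<open>f' v = 0\<close> at the unique sum
      \<open>c + d\<close>.\<close>
    have "scale ?s (Poly_Mapping.lookup v d) = 0"
      using lookup_monoid_scale_unique[OF c d uniq] less.prems(2,3) c by simp
    hence "Poly_Mapping.keys ?w \<subseteq> Poly_Mapping.keys v - {d}"
      by (auto simp: in_keys_iff lookup_monoid_scale_const scale_zero_right)
    hence "card (Poly_Mapping.keys ?w) < card (Poly_Mapping.keys v)"
      using d by (intro psubset_card_mono) auto
    \<comment> \<open>The constant \<open>?s\<close> commutes with \<open>f\<close> in
      \<open>S[G]\<close>.\<close>
    moreover have "monoid_scale scale f ?w = 0"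
      using v by (simp add: ann_def monoid_scale_monoid_scale mult.commute[of f]
          monoid_scale_zero_right flip: monoid_scale_monoid_scale[of _ f])
    ultimately have w: "?w = 0"
      using min[of ?w] by (auto simp: ann_def)
    show ?case
    proof (cases "a = c")
      case True
      thus ?thesis using w by simp
    next
      case False
      define f'' where "f'' = Poly_Mapping.update c 0 f'"
      have look: "Poly_Mapping.lookup f'' k = (if k = c then 0 else Poly_Mapping.lookup f' k)" for k
        by (simp add: f''_def lookup_update)
      have keys: "Poly_Mapping.keys f'' = Poly_Mapping.keys f' - {c}"
        by (simp add: f''_def keys_update)
      \<comment> \<open>With the dropped term factored as \<open>X\<^sup>c\<close> times a constant,
        its action on \<open>v\<close> is that of \<open>X\<^sup>c\<close> on
        \<open>?w = 0\<close>.\<close>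
      have "f' = f'' + Poly_Mapping.single c 1 * Poly_Mapping.single 0 ?s"
        using less.prems(3)[OF c]
        by (intro poly_mapping_eqI) (auto simp: look mult_single lookup_add lookup_single when_def)
      hence "monoid_scale scale f'' v = monoid_scale scale f' v"
        by (simp add: monoid_scale_add_left w monoid_scale_zero_right
            flip: monoid_scale_monoid_scale)
      moreover have "card (Poly_Mapping.keys f'') < card (Poly_Mapping.keys f')"
        using c unfolding keys by (intro psubset_card_mono) auto
      ultimately show ?thesis
        using less.hyps[of f''] less.prems False by (auto simp: keys look)
    qed
  qed
  \<comment> \<open>Any nonzero coefficient of \<open>v\<close> serves as \<open>m\<close>, since
    each coefficient of \<open>f\<close> kills all of \<open>v\<close>.\<close>
  obtain d where d: "Poly_Mapping.lookup v d \<noteq> 0"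
    using v by (auto simp: ann_def poly_mapping_eq_iff fun_eq_iff)
  have "scale (Poly_Mapping.lookup f g) (Poly_Mapping.lookup v d) = 0" for g
  proof (cases "g \<in> Poly_Mapping.keys f")
    case True
    hence "monoid_scale scale (Poly_Mapping.single 0 (Poly_Mapping.lookup f g)) v = 0"
      using v by (intro kill[of g f]) (auto simp: ann_def)
    thus ?thesis by (metis lookup_monoid_scale_const lookup_zero)
  qed (simp add: in_keys_iff scale_zero_left)
  thus ?thesis using d by blast
qed

end

section \<open>Zero-divisors of \<open>S[G]\<close> and content ideals\<close>

lemma semimodule_times: "semimodule ((*) :: 's::comm_semiring_1 \<Rightarrow> 's \<Rightarrow> 's)"
  by unfold_locales (simp_all add: algebra_simps)

text \<open>Lets McCoy's theorem for \<open>M = S\<close> speak about the zero-divisors of the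
  semiring \<open>S[G]\<close>.\<close>

lemma monoid_scale_times:
  fixes f g :: "'g::comm_monoid_add \<Rightarrow>\<^sub>0 's::comm_semiring_1"
  shows "monoid_scale (*) f g = f * g"
proof -
  interpret semimodule "(*) :: 's \<Rightarrow> 's \<Rightarrow> 's" by (rule semimodule_times)
  show ?thesis
  proof (induction f rule: poly_mapping_monomial_induct)
    case (3 a s)
    show ?case
      by (induction g rule: poly_mapping_monomial_induct)
         (simp_all add: monoid_scale_add_right monoid_scale_zero_right monoid_scale_single
           mult_single distrib_left)
  qed (simp_all add: monoid_scale_add_left monoid_scale_zero_left distrib_right)
qed

text \<open>Passes from the coefficients of \<open>f\<close> to the ideal they generate.\<close>

lemma semiring_ideal_annihilator: "semiring_ideal {s::'s::comm_semiring_1. s * c = 0}"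
  unfolding semiring_ideal_def by (auto simp: distrib_right mult.assoc intro: exI[of _ 0])

theorem theorem2p26:
  fixes scale :: "'s::comm_semiring_1 \<Rightarrow> 'm::comm_monoid_add \<Rightarrow> 'm"
  assumes "semimodule scale"
    and "\<exists>m::'m. m \<noteq> 0"
    and "auslander_semimodule scale"
    and "property_A scale"
    and "cancellative TYPE('g::comm_monoid_add)"
    and "torsion_free TYPE('g)"
  shows "auslander_semimodule
           (monoid_scale scale :: ('g \<Rightarrow>\<^sub>0 's) \<Rightarrow> ('g \<Rightarrow>\<^sub>0 'm) \<Rightarrow> ('g \<Rightarrow>\<^sub>0 'm))"
  unfolding auslander_semimodule_def
proof (intro conjI subsetI)
  interpret semimodule scale by fact
  interpret S: semimodule "(*) :: 's \<Rightarrow> 's \<Rightarrow> 's" by (rule semimodule_times)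
  show "semimodule (monoid_scale scale :: ('g \<Rightarrow>\<^sub>0 's) \<Rightarrow> _)"
    by (rule semimodule_monoid_scale)
  obtain m0 :: 'm where "m0 \<noteq> 0" using assms(2) by blast
  hence "Poly_Mapping.single (0::'g) m0 \<noteq> 0" by (metis single_zero inj_single injD)
  thus "\<exists>u :: 'g \<Rightarrow>\<^sub>0 'm. u \<noteq> 0" by blast
  fix f :: "'g \<Rightarrow>\<^sub>0 's"
  assume "f \<in> zero_divisors (*)"
  then obtain g where "g \<noteq> 0" "monoid_scale (*) f g = 0"
    unfolding zero_divisors_def monoid_scale_times by blast
  then obtain c where c: "c \<noteq> 0" "\<And>k. Poly_Mapping.lookup f k * c = 0"
    using S.McCoy[OF assms(5,6)] by blast
  define F where "F = Poly_Mapping.lookup f ` Poly_Mapping.keys f"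
  \<comment> \<open>A single \<open>c\<close> kills every generator of the content ideal, hence
    every element of it; killing the generators by different elements would not suffice.\<close>
  have "semiring_ideal hull F \<subseteq> {s. s * c = 0}"
    using c by (intro hull_minimal semiring_ideal_annihilator) (auto simp: F_def)
  also have "\<dots> \<subseteq> zero_divisors (*)"
    using c(1) by (auto simp: zero_divisors_def)
  also have "\<dots> \<subseteq> zero_divisors scale"
    using assms(3) by (simp add: auslander_semimodule_def)
  finally have "semiring_ideal hull F \<subseteq> zero_divisors scale" .
  moreover have "fin_gen_ideal (semiring_ideal hull F)"
    unfolding fin_gen_ideal_def by (intro exI[of _ F] conjI HOL.refl) (simp add: F_def)
  ultimately obtain m where m: "m \<noteq> 0" "\<forall>s\<in>semiring_ideal hull F. scale s m = 0"
    using assms(4) unfolding property_A_def by blast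
  have "scale (Poly_Mapping.lookup f k) m = 0" if "k \<in> Poly_Mapping.keys f" for k
    using m(2) that by (metis F_def hull_subset imageI subsetD)
  \<comment> \<open>The constant \<open>m X\<^sup>0\<close> is the nonzero element of
    \<open>M[G]\<close> annihilated by \<open>f\<close>.\<close>
  hence "monoid_scale scale f (Poly_Mapping.single 0 m) = 0"
    using m(1) by (simp add: monoid_scale_def)
  moreover have "Poly_Mapping.single (0::'g) m \<noteq> 0"
    using m(1) by (metis single_zero inj_single injD)
  ultimately show "f \<in> zero_divisors (monoid_scale scale)"
    unfolding zero_divisors_def by blast
qed

end
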